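(* Let $N\geqslant1$ be an integer and let $V:\mathbb{R}\to\mathbb{R}$ be $N$-periodic. For every $\eta_2\in[0,1[$, let $e_0(\eta_2)$ be the smallest eigenvalue of the real symmetric $N\times N$ matrix $H^{(0,\eta_2)}$. Then for every $\varphi=(\varphi_0,\dots,\varphi_{N-1})\in(\mathbb{R}^+\setminus\{0\})^N$, $$\min_{q\in\{0,\dots,N-1\}}\left(-\frac{\varphi_{q+1}+\varphi_{q-1}}{\varphi_q}+V(q+\eta_2)\right)\leqslant e_0(\eta_2)$$ and $$e_0(\eta_2)\leqslant\max_{q\in\{0,\dots,N-1\}}\left(-\frac{\varphi_{q+1}+\varphi_{q-1}}{\varphi_q}+V(q+\eta_2)\right),$$ where the indices labeling the components of $\varphi$ are taken modulo $N$.
   Context: $H^{(0,\eta_2)}$ is the matrix of the discrete Schrödinger operator $(Hu)_q=-u_{q+1}-u_{q-1}+V(q+\eta_2)u_q$ acting on $N$-periodic sequences ($u_{q+N}=u_q$), i.e. on $\mathbb{C}^N$ with indices modulo $N$. Explicitly (for $N\geqslant 3$) it has diagonal entries $V(q+\eta_2)$, $q=0,\dots,N-1$, entries $-1$ on the first sub- and super-diagonals and in the two corners $(0,N-1)$ and $(N-1,0)$, and zeros elsewhere. *)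

theory Defs
  imports "Jordan_Normal_Form.Spectral_Radius"
begin

(* Matrix of (H u)_q = - u_(q+1) - u_(q-1) + V (q + \<eta>) u_q with indices modulo N.
   The contributions of the two neighbours are added separately, because for N = 1 and N = 2
   the neighbours q + 1 and q - 1 coincide modulo N (for N = 1 also with q).
   On nat, q - 1 modulo N is written (q + N - 1) mod N, which avoids truncated subtraction. *)
definition schroedinger_mat :: "nat \<Rightarrow> (real \<Rightarrow> real) \<Rightarrow> real \<Rightarrow> real mat" where
  "schroedinger_mat N V \<eta> = mat N N (\<lambda>(q, r).
     - (if r = (q + 1) mod N then 1 else 0)
     - (if r = (q + N - 1) mod N then 1 else 0)
     + (if r = q then V (real q + \<eta>) else 0))"

(* Never the Min of an empty set on symmetric matrices of positive size, whose spectrum over the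
   reals is finite and nonempty. *)
definition smallest_eigenvalue :: "real mat \<Rightarrow> real" where
  "smallest_eigenvalue A = Min (spectrum A)"

definition local_energy :: "nat \<Rightarrow> (real \<Rightarrow> real) \<Rightarrow> real \<Rightarrow> real vec \<Rightarrow> nat \<Rightarrow> real" where
  "local_energy N V \<eta> \<phi> q =
     - ((\<phi> $ ((q + 1) mod N) + \<phi> $ ((q + N - 1) mod N)) / \<phi> $ q) + V (real q + \<eta>)"

lemma schroedinger_mat_carrier [simp]: "schroedinger_mat N V \<eta> \<in> carrier_mat N N"
  by (simp add: schroedinger_mat_def)

lemma schroedinger_mat_mult_vec:
  assumes "u \<in> carrier_vec N" and "q < N"
  shows "(schroedinger_mat N V \<eta> *\<^sub>v u) $ q =
    - u $ ((q + 1) mod N) - u $ ((q + N - 1) mod N) + V (real q + \<eta>) * u $ q"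
proof -
  let ?a = "(q + 1) mod N" and ?b = "(q + N - 1) mod N"
  have ab: "?a < N" "?b < N" using assms(2) by auto
  have "(schroedinger_mat N V \<eta> *\<^sub>v u) $ q =
    (\<Sum>r\<in>{0..<N}. (- (if r = ?a then 1 else 0) - (if r = ?b then 1 else 0)
       + (if r = q then V (real q + \<eta>) else 0)) * u $ r)"
    using assms by (simp add: schroedinger_mat_def scalar_prod_def)
  also have "\<dots> = (\<Sum>r\<in>{0..<N}. - (if r = ?a then u $ r else 0) - (if r = ?b then u $ r else 0)
       + (if r = q then V (real q + \<eta>) * u $ r else 0))"
    by (rule sum.cong) (auto simp: algebra_simps)
  also have "\<dots> = - u $ ?a - u $ ?b + V (real q + \<eta>) * u $ q"
    using ab assms(2) by (simp add: sum.distrib sum_subtractf sum_negf)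
  finally show ?thesis .
qed

lemma mod_succ_cases: "q < N \<Longrightarrow> (q + 1) mod N = (if q + 1 = N then 0 else q + 1)" for q N :: nat
  by auto

lemma mod_pred_cases: "q < N \<Longrightarrow> (q + N - 1) mod N = (if q = 0 then N - 1 else q - 1)" for q N :: nat
  by (cases q) auto

lemma schroedinger_mat_entries:
  assumes "3 \<le> N" "q < N" "r < N"
  shows "schroedinger_mat N V \<eta> $$ (q, r) =
    (if q = r then V (real q + \<eta>)
     else if r = q + 1 \<or> q = r + 1 \<or> (q = 0 \<and> r = N - 1) \<or> (q = N - 1 \<and> r = 0) then - 1
     else 0)"
  using assms unfolding schroedinger_mat_def
  by (simp only: index_mat prod.case mod_succ_cases mod_pred_cases) (auto split: if_splits)

lemma schroedinger_mat_symmetric: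
  "(schroedinger_mat N V \<eta>)\<^sup>T = schroedinger_mat N V \<eta>"
proof (rule eq_matI)
  fix q r assume "q < dim_row (schroedinger_mat N V \<eta>)" "r < dim_col (schroedinger_mat N V \<eta>)"
  then have *: "q < N" "r < N" by (simp_all add: schroedinger_mat_def)
  have "(q = (r + 1) mod N) = (r = (q + N - 1) mod N)"
       "(q = (r + N - 1) mod N) = (r = (q + 1) mod N)"
    using * by (simp_all only: mod_succ_cases mod_pred_cases) (auto split: if_splits)
  then show "(schroedinger_mat N V \<eta>)\<^sup>T $$ (q, r) = schroedinger_mat N V \<eta> $$ (q, r)"
    using * by (auto simp: schroedinger_mat_def)
qed (simp_all add: schroedinger_mat_def)

end

theory Submission
  imports Defs "HOL-Analysis.Function_Topology"
begin

text \<open>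
  For \<open>\<phi>\<close> with positive entries, the local energies \<open>E q\<close> are exactly the numbers
  with \<open>(H \<phi>) q = E q * \<phi> q\<close>, so both bounds compare the positive trial vector \<open>\<phi>\<close> with
  the smallest eigenvalue.

  The upper bound is the Rayleigh principle. The quotient \<open>(\<phi> \<bullet> H \<phi>) / (\<phi> \<bullet> \<phi>)\<close> is the
  mean of the \<open>E q\<close> with weights \<open>(\<phi> q)\<^sup>2\<close>, hence at most their maximum; and the smallest eigenvalue of
  a symmetric matrix is at most every Rayleigh quotient
  (\<open>smallest_eigenvalue_le_rayleigh\<close>). The latter is proved without a spectral theorem: the quadratic
  form attains its minimum on the unit sphere by compactness
  (\<open>rayleigh_quotient_attains_minimum\<close>), and the first variation vanishes there, so the minimizer is an
  eigenvector (\<open>eigenvector_if_rayleigh_minimizer\<close>). This argument also shows that the real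
  spectrum is nonempty, which gives meaning to the word smallest.

  The lower bound is a maximum principle, and it holds for every real eigenvalue \<open>k\<close>
  (\<open>ex_local_energy_le_eigenvalue\<close>). If \<open>u\<close> is an eigenvector, choose a site \<open>q\<close> where
  \<open>\<bar>u q\<bar> / \<phi> q\<close> is largest and normalise the sign so that \<open>u q > 0\<close>. Then \<open>u\<close> is bounded by
  a multiple of \<open>\<phi>\<close> that touches it at \<open>q\<close>. As the couplings of \<open>H\<close> to neighbouring sites
  are negative, the eigenvalue equation at \<open>q\<close> yields \<open>k \<ge> E q\<close>.
\<close>

section \<open>Minimizing the Rayleigh quotient of a symmetric matrix\<close>

lemma scalar_prod_self_eq_0_iff:
  fixes v :: "real vec"
  assumes "v \<in> carrier_vec n"
  shows "v \<bullet> v = 0 \<longleftrightarrow> v = 0\<^sub>v n"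
proof
  assume "v \<bullet> v = 0"
  then have "(\<Sum>i\<in>{0..<n}. v $ i * v $ i) = 0"
    using assms by (simp add: scalar_prod_def)
  then have "\<forall>i\<in>{0..<n}. v $ i * v $ i = 0"
    by (subst (asm) sum_nonneg_eq_0_iff) auto
  then show "v = 0\<^sub>v n" using assms by (intro eq_vecI) auto
qed (use assms in simp)

lemma scalar_prod_self_nonneg:
  fixes v :: "real vec"
  shows "0 \<le> v \<bullet> v"
  by (auto simp: scalar_prod_def intro: sum_nonneg)

lemma scalar_prod_mult_mat_vec_commute:
  fixes A :: "real mat"
  assumes A: "A \<in> carrier_mat n n" and sym: "A\<^sup>T = A"
    and u: "u \<in> carrier_vec n" and v: "v \<in> carrier_vec n"
  shows "u \<bullet> (A *\<^sub>v v) = v \<bullet> (A *\<^sub>v u)"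
proof -
  have "u \<bullet> (A *\<^sub>v v) = (A *\<^sub>v u) \<bullet> v"
    using transpose_vec_mult_scalar[OF A v u] sym by simp
  also have "\<dots> = v \<bullet> (A *\<^sub>v u)"
    using A u v by (intro comm_scalar_prod[of _ n]) auto
  finally show ?thesis .
qed

text \<open>
  The dimension \<open>n\<close> is a number and not a type, so the sphere of \<open>n\<close>-dimensional space is
  taken inside the sequences with the product topology, where Tychonoff's theorem
  makes the enclosing cube compact.
\<close>
lemma compact_finite_unit_sphere:
  "compact {f :: nat \<Rightarrow> real. (\<forall>i\<ge>n. f i = 0) \<and> (\<Sum>i<n. (f i)\<^sup>2) = 1}" (is "compact ?S")
proof -
  let ?B = "PiE UNIV (\<lambda>i. if i < n then {-1..1} else {0}) :: (nat \<Rightarrow> real) set"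
  have "compactin (product_topology (\<lambda>i. euclidean) UNIV) ?B"
    by (subst compactin_PiE) auto
  then have B: "compact ?B" by (simp add: euclidean_product_topology)
  have "closed {f :: nat \<Rightarrow> real. (\<Sum>i<n. (f i)\<^sup>2) = 1}"
    by (intro closed_Collect_eq continuous_intros continuous_on_product_coordinates)
  then have "compact (?B \<inter> {f. (\<Sum>i<n. (f i)\<^sup>2) = 1})"
    using B by (rule compact_Int_closed[rotated])
  also have "?B \<inter> {f. (\<Sum>i<n. (f i)\<^sup>2) = 1} = ?S"
  proof (intro equalityI subsetI)
    fix f assume f: "f \<in> ?S"
    have "\<bar>f i\<bar> \<le> 1" if "i < n" for i
    proof -
      have "(f i)\<^sup>2 \<le> (\<Sum>i<n. (f i)\<^sup>2)"
        using that by (intro member_le_sum) auto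
      then show ?thesis using f by (simp add: abs_square_le_1)
    qed
    then show "f \<in> ?B \<inter> {f. (\<Sum>i<n. (f i)\<^sup>2) = 1}"
      using f by (auto simp: abs_le_iff minus_le_iff)
  qed (auto simp: PiE_iff split: if_splits dest: leD)
  finally show ?thesis .
qed

text \<open>
  Compactness gives a minimizer among unit vectors; homogeneity of degree two carries
  the bound to all vectors. Clearing the denominator includes the zero vector.
\<close>
lemma rayleigh_quotient_attains_minimum:
  fixes A :: "real mat"
  assumes A: "A \<in> carrier_mat n n" and n: "n > 0"
  obtains u m where "u \<in> carrier_vec n" "u \<noteq> 0\<^sub>v n" "u \<bullet> (A *\<^sub>v u) = m * (u \<bullet> u)"
    "\<And>v. v \<in> carrier_vec n \<Longrightarrow> m * (v \<bullet> v) \<le> v \<bullet> (A *\<^sub>v v)"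
proof -
  let ?S = "{f :: nat \<Rightarrow> real. (\<forall>i\<ge>n. f i = 0) \<and> (\<Sum>i<n. (f i)\<^sup>2) = 1}"
  \<comment> \<open>The quadratic form as an explicit polynomial in the coordinates, so that its continuity
    in the product topology is immediate.\<close>
  define R where "R f = (\<Sum>i<n. f i * (\<Sum>j<n. A $$ (i,j) * f j))" for f :: "nat \<Rightarrow> real"
  have R: "R f = vec n f \<bullet> (A *\<^sub>v vec n f)" for f
    using A by (simp add: R_def scalar_prod_def row_def atLeast0LessThan)
  have norm: "(\<Sum>i<n. (f i)\<^sup>2) = vec n f \<bullet> vec n f" for f :: "nat \<Rightarrow> real"
    by (simp add: scalar_prod_def power2_eq_square atLeast0LessThan)
  have "continuous_on UNIV R"
    unfolding R_def by (intro continuous_intros continuous_on_product_coordinates)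
  then have cont: "continuous_on ?S R"
    by (rule continuous_on_subset) simp
  define e where "e i = (if i = 0 then 1 else 0 :: real)" for i :: nat
  have "(\<Sum>i<n. (e i)\<^sup>2) = (\<Sum>i<n. if i = 0 then 1 else 0)"
    by (rule sum.cong) (auto simp: e_def)
  also have "\<dots> = 1" using n by simp
  finally have "e \<in> ?S" using n by (simp add: e_def)
  then have "?S \<noteq> {}" by blast
  then have "\<exists>f\<in>?S. \<forall>g\<in>?S. R f \<le> R g"
    using continuous_attains_inf[OF compact_finite_unit_sphere _ cont] by simp
  then obtain f where f: "f \<in> ?S" and min_all: "\<forall>g\<in>?S. R f \<le> R g" by (rule bexE)
  have min: "R f \<le> R g" if "g \<in> ?S" for g using min_all that by (rule bspec)
  let ?u = "vec n f"
  have u1: "?u \<bullet> ?u = 1" using f norm[of f] by simp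
  show thesis
  proof (rule that[of ?u "R f"])
    show "?u \<noteq> 0\<^sub>v n" using u1 by auto
    show "?u \<bullet> (A *\<^sub>v ?u) = R f * (?u \<bullet> ?u)" using u1 R by simp
    fix v :: "real vec" assume v: "v \<in> carrier_vec n"
    show "R f * (v \<bullet> v) \<le> v \<bullet> (A *\<^sub>v v)"
    proof (cases "v = 0\<^sub>v n")
      case True
      then show ?thesis using A by (simp add: scalar_prod_self_nonneg)
    next
      case False
      define c where "c = sqrt (v \<bullet> v)"
      have vv: "v \<bullet> v > 0"
        using False scalar_prod_self_eq_0_iff[OF v] scalar_prod_self_nonneg[of v] by linarith
      then have c: "c > 0" "c * c = v \<bullet> v" by (auto simp: c_def vv less_imp_le)
      define g where "g i = (if i < n then v $ i / c else 0)" for i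
      have g: "vec n g = (1 / c) \<cdot>\<^sub>v v" using v by (intro eq_vecI) (auto simp: g_def)
      have "vec n g \<bullet> vec n g = 1" unfolding g using v vv c
        by (simp add: field_simps)
      then have "R f \<le> R g" by (intro min) (auto simp: g_def norm)
      also have "R g = (v \<bullet> (A *\<^sub>v v)) / (c * c)"
        unfolding R g using A v by (simp add: mult_mat_vec[of A n n] field_simps)
      finally show ?thesis using vv by (simp add: c(2) pos_le_divide_eq)
    qed
  qed simp
qed

text \<open>
  The first-order condition at \<open>t = 0\<close> for a quadratic polynomial in \<open>t\<close>: for small \<open>t\<close>
  of sign opposite to \<open>a\<close> the linear term would dominate and be negative.
\<close>
lemma linear_coeff_eq_0_if_quadratic_nonneg:
  fixes a b :: real
  assumes "\<And>t. 0 \<le> 2 * t * a + t\<^sup>2 * b"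
  shows "a = 0"
proof (rule ccontr)
  assume a: "a \<noteq> 0"
  \<comment> \<open>At \<open>t = - a / c\<close> the value is \<open>a\<^sup>2 * (b - 2 * c) / c\<^sup>2\<close>, negative as soon as \<open>c\<close> is
    positive and exceeds \<open>b\<close>.\<close>
  define c where "c = \<bar>b\<bar> + 1"
  have c: "c > 0" "b < c" by (auto simp: c_def)
  have "0 \<le> (2 * (- a / c) * a + (- a / c)\<^sup>2 * b) * c\<^sup>2"
    using assms[of "- a / c"] by simp
  also have "\<dots> = a\<^sup>2 * (b - 2 * c)"
    using c by (simp add: field_simps power2_eq_square)
  also have "\<dots> < 0" using a c by (intro mult_pos_neg) auto
  finally show False by simp
qed

text \<open>
  The form \<open>v \<bullet> A v - m * (v \<bullet> v)\<close> is nonnegative and vanishes at \<open>u\<close>. Perturbing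
  \<open>u\<close> in the direction of the residual \<open>w = A u - m u\<close>, symmetry of \<open>A\<close> makes \<open>w \<bullet> w\<close>
  half the first-order coefficient, so \<open>w\<close> is zero.
\<close>
lemma eigenvector_if_rayleigh_minimizer:
  fixes A :: "real mat"
  assumes A: "A \<in> carrier_mat n n" and sym: "A\<^sup>T = A"
    and u: "u \<in> carrier_vec n" "u \<noteq> 0\<^sub>v n" "u \<bullet> (A *\<^sub>v u) = m * (u \<bullet> u)"
    and min: "\<And>v. v \<in> carrier_vec n \<Longrightarrow> m * (v \<bullet> v) \<le> v \<bullet> (A *\<^sub>v v)"
  shows "eigenvector A u m"
proof -
  define w where "w = A *\<^sub>v u - m \<cdot>\<^sub>v u"
  have Au: "A *\<^sub>v u \<in> carrier_vec n" and w: "w \<in> carrier_vec n"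
    and Aw: "A *\<^sub>v w \<in> carrier_vec n"
    using A u by (auto simp: w_def)
  have "0 \<le> 2 * t * (w \<bullet> w) + t\<^sup>2 * (w \<bullet> (A *\<^sub>v w) - m * (w \<bullet> w))" for t
  proof -
    let ?v = "u + t \<cdot>\<^sub>v w"
    have "A *\<^sub>v ?v = A *\<^sub>v u + t \<cdot>\<^sub>v (A *\<^sub>v w)"
      using A u w by (simp add: mult_add_distrib_mat_vec[of _ n n] mult_mat_vec[of A n n])
    then have "?v \<bullet> (A *\<^sub>v ?v) = u \<bullet> (A *\<^sub>v u) + t * (u \<bullet> (A *\<^sub>v w)) + t * (w \<bullet> (A *\<^sub>v u))
        + t\<^sup>2 * (w \<bullet> (A *\<^sub>v w))"
      using u w Au Aw
      by (simp add: add_scalar_prod_distrib[of _ n] scalar_prod_add_distrib[of _ n]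
          power2_eq_square algebra_simps)
    moreover have "u \<bullet> (A *\<^sub>v w) = w \<bullet> (A *\<^sub>v u)"
      using scalar_prod_mult_mat_vec_commute[OF A sym u(1) w] .
    moreover have "?v \<bullet> ?v = u \<bullet> u + 2 * t * (w \<bullet> u) + t\<^sup>2 * (w \<bullet> w)"
      using u w comm_scalar_prod[of u n w]
      by (simp add: add_scalar_prod_distrib[of _ n] scalar_prod_add_distrib[of _ n]
          power2_eq_square algebra_simps)
    ultimately have "?v \<bullet> (A *\<^sub>v ?v) - m * (?v \<bullet> ?v)
        = 2 * t * (w \<bullet> (A *\<^sub>v u) - m * (w \<bullet> u)) + t\<^sup>2 * (w \<bullet> (A *\<^sub>v w) - m * (w \<bullet> w))"
      using u(3) by (simp only:) (simp add: algebra_simps)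
    moreover have "w \<bullet> (A *\<^sub>v u) - m * (w \<bullet> u) = w \<bullet> w"
      using scalar_prod_minus_distrib[OF w Au, of "m \<cdot>\<^sub>v u"] u w by (simp add: w_def[symmetric])
    moreover have "m * (?v \<bullet> ?v) \<le> ?v \<bullet> (A *\<^sub>v ?v)"
      using u w by (intro min) simp
    ultimately show ?thesis by simp
  qed
  then have "w \<bullet> w = 0" by (rule linear_coeff_eq_0_if_quadratic_nonneg)
  then have w0: "w = 0\<^sub>v n" using scalar_prod_self_eq_0_iff[OF w] by simp
  have "A *\<^sub>v u = m \<cdot>\<^sub>v u"
  proof (rule eq_vecI)
    fix i assume "i < dim_vec (m \<cdot>\<^sub>v u)"
    then have i: "i < n" using u by simp
    have "w $ i = 0" using w0 i by simp
    then show "(A *\<^sub>v u) $ i = (m \<cdot>\<^sub>v u) $ i"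
      using i A u by (simp add: w_def)
  qed (use A u in simp)
  then show ?thesis using A u by (simp add: eigenvector_def)
qed

text \<open>
  The minimum of the Rayleigh quotient is itself an eigenvalue, so the real spectrum
  is nonempty and its minimum lies below the minimal quotient.
\<close>
lemma smallest_eigenvalue_variational:
  fixes A :: "real mat"
  assumes A: "A \<in> carrier_mat n n" and sym: "A\<^sup>T = A" and n: "n > 0"
  shows smallest_eigenvalue_is_eigenvalue: "eigenvalue A (smallest_eigenvalue A)"
    and smallest_eigenvalue_le_rayleigh:
      "v \<in> carrier_vec n \<Longrightarrow> smallest_eigenvalue A * (v \<bullet> v) \<le> v \<bullet> (A *\<^sub>v v)"
proof -
  obtain u m where *: "u \<in> carrier_vec n" "u \<noteq> 0\<^sub>v n" "u \<bullet> (A *\<^sub>v u) = m * (u \<bullet> u)"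
    "\<And>v. v \<in> carrier_vec n \<Longrightarrow> m * (v \<bullet> v) \<le> v \<bullet> (A *\<^sub>v v)"
    using rayleigh_quotient_attains_minimum[OF A n] by blast
  have m: "m \<in> spectrum A"
    using eigenvector_if_rayleigh_minimizer[OF A sym *]
    by (auto simp: spectrum_def eigenvalue_def)
  have fin: "finite (spectrum A)" using card_finite_spectrum[OF A] by simp
  have "Min (spectrum A) \<in> spectrum A" using m fin by (intro Min_in) auto
  then show "eigenvalue A (smallest_eigenvalue A)"
    by (simp add: smallest_eigenvalue_def spectrum_def)
  assume v: "v \<in> carrier_vec n"
  have "smallest_eigenvalue A \<le> m" using m fin by (simp add: smallest_eigenvalue_def)
  then have "smallest_eigenvalue A * (v \<bullet> v) \<le> m * (v \<bullet> v)"
    using scalar_prod_self_nonneg by (rule mult_right_mono)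
  with *(4)[OF v] show "smallest_eigenvalue A * (v \<bullet> v) \<le> v \<bullet> (A *\<^sub>v v)" by linarith
qed

section \<open>Local energies of a positive vector\<close>

lemma schroedinger_mat_mult_pos_vec:
  assumes "\<phi> \<in> carrier_vec N" and "q < N" and "\<phi> $ q > 0"
  shows "(schroedinger_mat N V \<eta> *\<^sub>v \<phi>) $ q = local_energy N V \<eta> \<phi> q * \<phi> $ q"
  using assms by (simp add: schroedinger_mat_mult_vec local_energy_def field_simps)

text \<open>
  A discrete maximum principle. At a site where \<open>\<bar>u q\<bar> / \<phi> q\<close> is maximal, the
  neighbouring values of the eigenvector \<open>u\<close>, taken with the sign of \<open>u q\<close>, are at most those of the touching multiple of
  \<open>\<phi>\<close>; since they enter \<open>H\<close> with negative sign, replacing them by \<open>\<phi>\<close> can only lower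
  the right-hand side of the eigenvalue equation at \<open>q\<close>.
\<close>
lemma ex_local_energy_le_eigenvalue:
  assumes ev: "eigenvalue (schroedinger_mat N V \<eta>) k" and N: "N > 0"
    and pos: "\<And>q. q < N \<Longrightarrow> \<phi> $ q > 0"
  obtains q where "q < N" "local_energy N V \<eta> \<phi> q \<le> k"
proof -
  let ?H = "schroedinger_mat N V \<eta>"
  obtain u where u: "u \<in> carrier_vec N" "u \<noteq> 0\<^sub>v N" "?H *\<^sub>v u = k \<cdot>\<^sub>v u"
    using ev by (auto simp: eigenvalue_def eigenvector_def schroedinger_mat_def)
  define r where "r q = \<bar>u $ q\<bar> / \<phi> $ q" for q
  have "Max (r ` {0..<N}) \<in> r ` {0..<N}" using N by (intro Max_in) auto
  then obtain q where q: "q < N" and Mq: "Max (r ` {0..<N}) = r q" by auto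
  have r_le: "r p \<le> r q" if "p < N" for p
    unfolding Mq[symmetric] using that by (intro Max_ge) auto
  have bound: "\<bar>u $ p\<bar> \<le> r q * \<phi> $ p" if "p < N" for p
    using r_le[OF that] pos[OF that] by (simp add: r_def[of p] field_simps)
  have "r q > 0"
  proof -
    obtain p where p: "p < N" "u $ p \<noteq> 0" using u by (metis carrier_vecD eq_vecI index_zero_vec)
    then have "r p > 0" using pos[of p] by (simp add: r_def)
    then show ?thesis using r_le[OF p(1)] by linarith
  qed
  let ?a = "(q + 1) mod N" and ?b = "(q + N - 1) mod N"
  \<comment> \<open>Multiplying by this sign replaces the usual reduction to the case \<open>u q > 0\<close>.\<close>
  let ?s = "sgn (u $ q)"
  have uq: "?s * u $ q = r q * \<phi> $ q"
    using pos[OF q] by (simp add: r_def sgn_mult_self_eq abs_sgn mult.commute)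
  have neighbour: "?s * u $ p \<le> r q * \<phi> $ p" if "p < N" for p
    using bound[OF that] by (auto simp: sgn_if)
  have "k * u $ q = - u $ ?a - u $ ?b + V (real q + \<eta>) * u $ q"
    using schroedinger_mat_mult_vec[OF u(1) q, of V \<eta>] u q by simp
  then have "?s * (k * u $ q) = ?s * (- u $ ?a - u $ ?b + V (real q + \<eta>) * u $ q)"
    by simp
  then have "k * (?s * u $ q) = - (?s * u $ ?a) - ?s * u $ ?b + V (real q + \<eta>) * (?s * u $ q)"
    by (simp add: algebra_simps)
  then have "k * (r q * \<phi> $ q) =
      - (?s * u $ ?a) - ?s * u $ ?b + V (real q + \<eta>) * (r q * \<phi> $ q)"
    unfolding uq .
  also have "\<dots> \<ge> - (r q * \<phi> $ ?a) - r q * \<phi> $ ?b + V (real q + \<eta>) * (r q * \<phi> $ q)"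
    using neighbour[of ?a] neighbour[of ?b] N by simp
  also have "- (r q * \<phi> $ ?a) - r q * \<phi> $ ?b + V (real q + \<eta>) * (r q * \<phi> $ q)
      = local_energy N V \<eta> \<phi> q * (r q * \<phi> $ q)"
    using pos[OF q] by (simp add: local_energy_def field_simps)
  finally have "local_energy N V \<eta> \<phi> q \<le> k"
    using \<open>r q > 0\<close> pos[OF q] by (simp add: mult_le_cancel_right)
  with q show thesis by (rule that)
qed

theorem proposition6:
  fixes N :: nat and V :: "real \<Rightarrow> real" and \<eta>\<^sub>2 :: real and \<phi> :: "real vec"
  assumes "N \<ge> 1"
    and "\<And>x. V (x + real N) = V x"
    and "\<eta>\<^sub>2 \<in> {0..<1}"
    and "\<phi> \<in> carrier_vec N"
    and "\<And>q. q < N \<Longrightarrow> \<phi> $ q > 0"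
  shows "Min (local_energy N V \<eta>\<^sub>2 \<phi> ` {0..<N})
           \<le> smallest_eigenvalue (schroedinger_mat N V \<eta>\<^sub>2)
       \<and> smallest_eigenvalue (schroedinger_mat N V \<eta>\<^sub>2)
           \<le> Max (local_energy N V \<eta>\<^sub>2 \<phi> ` {0..<N})"
proof
  let ?H = "schroedinger_mat N V \<eta>\<^sub>2" and ?E = "local_energy N V \<eta>\<^sub>2 \<phi>"
  have N: "N > 0" using assms(1) by simp
  note sym = schroedinger_mat_carrier schroedinger_mat_symmetric N
  obtain q where "q < N" "?E q \<le> smallest_eigenvalue ?H"
    using ex_local_energy_le_eigenvalue[OF smallest_eigenvalue_is_eigenvalue[OF sym] N assms(5)]
    by blast
  then show "Min (?E ` {0..<N}) \<le> smallest_eigenvalue ?H"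
    by (auto simp: Min_le_iff)
  let ?M = "Max (?E ` {0..<N})"
  have "smallest_eigenvalue ?H * (\<phi> \<bullet> \<phi>) \<le> \<phi> \<bullet> (?H *\<^sub>v \<phi>)"
    using smallest_eigenvalue_le_rayleigh[OF sym assms(4)] .
  also have "\<dots> = (\<Sum>q\<in>{0..<N}. \<phi> $ q * (?H *\<^sub>v \<phi>) $ q)"
    by (simp add: scalar_prod_def schroedinger_mat_def)
  \<comment> \<open>The Rayleigh quotient of \<open>\<phi>\<close> is a weighted mean of the local energies.\<close>
  also have "\<dots> = (\<Sum>q\<in>{0..<N}. ?E q * (\<phi> $ q * \<phi> $ q))"
    using assms(4,5) by (intro sum.cong) (auto simp: schroedinger_mat_mult_pos_vec)
  also have "\<dots> \<le> (\<Sum>q\<in>{0..<N}. ?M * (\<phi> $ q * \<phi> $ q))"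
    by (intro sum_mono mult_right_mono Max_ge) auto
  also have "\<dots> = ?M * (\<phi> \<bullet> \<phi>)"
    using assms(4) by (simp add: scalar_prod_def sum_distrib_left)
  finally have "smallest_eigenvalue ?H * (\<phi> \<bullet> \<phi>) \<le> ?M * (\<phi> \<bullet> \<phi>)" .
  moreover have "\<phi> \<bullet> \<phi> > 0"
    using N assms(4,5) by (auto simp: scalar_prod_def intro!: sum_pos)
  ultimately show "smallest_eigenvalue ?H \<le> ?M" by simp
qed

end
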